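(* Let $\Lambda=\{1,\dots,N\}$, and for each $i\in\Lambda$ let $X_i\subseteq\mathbb R^{n_i}$; put $n=\sum_{i\in\Lambda} n_i$ and $X=\prod_{i\in\Lambda}X_i\subseteq\mathbb R^n$. Assume that for each $i\in\Lambda$: (a) the multi-valued map $K_i:X\rightrightarrows X_i$ admits non-empty values; (b) the multi-valued map $P_i:X\rightrightarrows X_i$ has open upper sections. For $x\in X$ set $T_i(x)=co\big(\mathcal N_{\tilde P_i}(x)\cap S_i[0,1]\big)$, $T(x)=\prod_{i\in\Lambda}T_i(x)$ and $K(x)=\prod_{i\in\Lambda}K_i(x)$. Then every solution of the quasi-variational inequality $QVI(T,K)$ is an equilibrium for the generalized Nash game $\Gamma=(X_i,K_i,P_i)_{i\in\Lambda}$.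
   Context: Notation: $x=(x_i)_{i\in\Lambda}=(x_{-i},x_i)$, where $x_{-i}$ collects the components of all players except $i$; $co(C)$ is the convex hull of $C$. Values of $P_i$ may be empty. Open upper sections: $P_i$ has open upper sections if $P_i(x)$ is open (as a subset of $\mathbb R^{n_i}$) for every $x\in X$. $\tilde P_i(x)=co(P_i(x))$, and $\mathcal N_{\tilde P_i}(x)=\{y^*\in\mathbb R^{n_i}\mid \langle y^*,z-x_i\rangle\le 0\ \ \forall z\in\tilde P_i(x)\}$, which equals $\mathbb R^{n_i}$ when $\tilde P_i(x)=\emptyset$. $S_i[0,1]=\{v\in\mathbb R^{n_i}\mid\|v\|=1\}$ is the unit sphere for the Euclidean norm. $QVI(T,K)$: a solution is a point $\bar x\in K(\bar x)$ for which there exists $\bar x^*\in T(\bar x)$ with $\langle\bar x^*,z-\bar x\rangle\ge0$ for all $z\in K(\bar x)$. Equilibrium: $\tilde x\in X$ is an equilibrium for $\Gamma$ if, for each $i\in\Lambda$, $\tilde x_i\in K_i(\tilde x)$ and $P_i(\tilde x)\cap K_i(\tilde x)=\emptyset$. *)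

theory Defs
  imports "HOL-Analysis.Analysis"
begin

text \<open>
  The players are the elements of a finite type \<open>'p\<close>, so that \<open>N = CARD('p)\<close>. As the dimensions
  \<open>n\<^sub>i\<close> may differ from player to player, the coordinates of player \<open>i\<close> are labelled by a set
  \<open>C i\<close> of \<open>n\<^sub>i\<close> elements of a finite type \<open>'m\<close>, and the
  Euclidean space of dimension \<open>n\<^sub>i\<close> is \<open>coord_space (C i)\<close>, the vectors of \<open>real ^ 'm\<close> vanishing outside \<open>C i\<close>. Since \<open>'m\<close> is
  arbitrary, so are the \<open>n\<^sub>i\<close>. A strategy profile is \<open>x :: real ^ 'm ^ 'p\<close> with
  \<open>x\<^sub>i = x $ i\<close>; the inner product of \<open>real ^ 'm ^ 'p\<close> is the sum over the players of the
  inner products of the components, so on the product of the coordinate spaces it is the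
  standard inner product of the space of dimension \<open>n = \<Sum>\<^sub>i n\<^sub>i\<close>.
\<close>

definition coord_space :: "'m set \<Rightarrow> (real ^ 'm) set" where
  "coord_space A = {v. \<forall>k. k \<notin> A \<longrightarrow> v $ k = 0}"

definition strategy_product :: "('p \<Rightarrow> 'a set) \<Rightarrow> ('a ^ 'p) set" where
  "strategy_product Y = {x. \<forall>i. x $ i \<in> Y i}"

definition multimap :: "'a set \<Rightarrow> 'b set \<Rightarrow> ('a \<Rightarrow> 'b set) \<Rightarrow> bool" where
  "multimap A B F \<longleftrightarrow> (\<forall>x\<in>A. F x \<subseteq> B)"

text \<open>Openness is relative to the whole space \<open>E\<close> containing the values of \<open>F\<close>.\<close>

definition open_upper_sections ::
    "'a set \<Rightarrow> 'b::topological_space set \<Rightarrow> ('a \<Rightarrow> 'b set) \<Rightarrow> bool" where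
  "open_upper_sections A E F \<longleftrightarrow> (\<forall>x\<in>A. openin (top_of_set E) (F x))"

text \<open>\<open>normal_map E Q p\<close> is the set-valued map \<open>\<N>\<^sub>Q\<close>, where \<open>E\<close> is the own space of the player
  and \<open>p x\<close> the component of \<open>x\<close> belonging to that player.\<close>

definition normal_map ::
    "'b::real_inner set \<Rightarrow> ('a \<Rightarrow> 'b set) \<Rightarrow> ('a \<Rightarrow> 'b) \<Rightarrow> 'a \<Rightarrow> 'b set" where
  "normal_map E Q p x = {y \<in> E. \<forall>z\<in>Q x. inner y (z - p x) \<le> 0}"

definition player_T ::
    "('p::finite \<Rightarrow> 'm::finite set) \<Rightarrow> ('p \<Rightarrow> real ^ 'm ^ 'p \<Rightarrow> (real ^ 'm) set) \<Rightarrow>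
      'p \<Rightarrow> real ^ 'm ^ 'p \<Rightarrow> (real ^ 'm) set" where
  "player_T C P i x =
     convex hull
       (normal_map (coord_space (C i)) (\<lambda>x. convex hull (P i x)) (\<lambda>x. x $ i) x
        \<inter> {v \<in> coord_space (C i). norm v = 1})"

text \<open>The maps of a quasi-variational inequality are only defined on \<open>A\<close>, hence the explicit
  requirement that a solution lie in \<open>A\<close>.\<close>

definition QVI_solution ::
    "'a::real_inner set \<Rightarrow> ('a \<Rightarrow> 'a set) \<Rightarrow> ('a \<Rightarrow> 'a set) \<Rightarrow> 'a \<Rightarrow> bool" where
  "QVI_solution A T K x \<longleftrightarrow>
     x \<in> A \<and> x \<in> K x \<and> (\<exists>y\<in>T x. \<forall>z\<in>K x. inner y (z - x) \<ge> 0)"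

definition equilibrium ::
    "('p::finite \<Rightarrow> 'a set) \<Rightarrow> ('p \<Rightarrow> 'a ^ 'p \<Rightarrow> 'a set) \<Rightarrow> ('p \<Rightarrow> 'a ^ 'p \<Rightarrow> 'a set) \<Rightarrow>
      'a ^ 'p \<Rightarrow> bool" where
  "equilibrium X K P x \<longleftrightarrow>
     x \<in> strategy_product X \<and> (\<forall>i. x $ i \<in> K i x \<and> P i x \<inter> K i x = {})"

end

theory Submission
  imports Defs
begin

text \<open>
  A point \<open>w\<close> of an open set is not a maximiser over that set of a nonzero linear functional, so every unit
  normal \<open>v\<close> to \<open>co (P i x)\<close> satisfies \<open>\<langle>v, w - x\<^sub>i\<rangle> < 0\<close> for each \<open>w \<in> P i x\<close>. This
  strict inequality survives the convex hull in the definition of \<open>T\<^sub>i\<close>, so such a \<open>w\<close> in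
  \<open>K i x\<close> would violate the variational inequality at the profile in which player \<open>i\<close> alone
  deviates to \<open>w\<close>.
\<close>

lemma subspace_coord_space: "subspace (coord_space A)"
  by (auto simp: coord_space_def subspace_def)

text \<open>A short step from \<open>w\<close> along \<open>v\<close> stays in \<open>Q\<close>,
  because \<open>v\<close> is a direction of \<open>E\<close>, and it raises the functional by
  \<open>t * inner v v > 0\<close>. Since the value after the step is still at most 0, the value at
  \<open>w\<close> is negative.\<close>

lemma normal_to_openin_neg:
  fixes E :: "'b::real_inner set"
  assumes E: "subspace E" and Q: "openin (top_of_set E) Q" and w: "w \<in> Q"
    and v: "v \<in> E" "v \<noteq> 0" and le: "\<And>z. z \<in> Q \<Longrightarrow> inner v (z - a) \<le> 0"
  shows "inner v (w - a) < 0"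
proof -
  obtain e where e: "e > 0" "ball w e \<inter> E \<subseteq> Q" and wE: "w \<in> E"
    using Q w unfolding openin_contains_ball by blast
  \<comment> \<open>This choice gives the step \<open>t *\<^sub>R v\<close> the length
    \<open>e / 2\<close>, strictly inside the ball.\<close>
  define t where "t = e / (2 * norm v)"
  have t: "t > 0"
    using e v by (simp add: t_def)
  have "norm (t *\<^sub>R v) < e"
    using e v by (simp add: t_def)
  moreover have "w + t *\<^sub>R v \<in> E"
    using E wE v by (simp add: subspace_add subspace_scale)
  ultimately have "w + t *\<^sub>R v \<in> Q"
    using e by (auto simp: dist_norm)
  from le[OF this] have "inner v (w - a) + t * inner v v \<le> 0"
    by (simp add: inner_add_right inner_diff_right algebra_simps)
  moreover have "t * inner v v > 0"
    using t v by simp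
  ultimately show ?thesis by linarith
qed

lemma player_T_neg:
  assumes "openin (top_of_set (coord_space (C i))) (P i x)"
    and "w \<in> P i x" and "y \<in> player_T C P i x"
  shows "inner y (w - x $ i) < 0"
proof -
  \<comment> \<open>The open half-space is convex, so it contains the hull as soon as it contains
    the unit normals.\<close>
  have "player_T C P i x \<subseteq> {v. inner (w - x $ i) v < 0}"
    unfolding player_T_def
  proof (rule hull_minimal)
    show "normal_map (coord_space (C i)) (\<lambda>x. convex hull P i x) (\<lambda>x. x $ i) x
        \<inter> {v \<in> coord_space (C i). norm v = 1} \<subseteq> {v. inner (w - x $ i) v < 0}"
    proof
      fix v
      assume "v \<in> normal_map (coord_space (C i)) (\<lambda>x. convex hull P i x) (\<lambda>x. x $ i) x
        \<inter> {v \<in> coord_space (C i). norm v = 1}"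
      \<comment> \<open>Norm 1 rules out \<open>v = 0\<close>; the normal inequality on the hull is
        restricted to \<open>P i x\<close>, the set assumed open.\<close>
      then have "v \<in> coord_space (C i)" "v \<noteq> 0"
        "\<And>z. z \<in> P i x \<Longrightarrow> inner v (z - x $ i) \<le> 0"
        by (auto simp: normal_map_def hull_inc)
      from normal_to_openin_neg[OF subspace_coord_space assms(1,2) this]
      show "v \<in> {v. inner (w - x $ i) v < 0}"
        by (simp add: inner_commute)
    qed
  qed (rule convex_halfspace_lt)
  with assms(3) show ?thesis
    by (auto simp: inner_commute)
qed

text \<open>All summands but the one of player \<open>i\<close> vanish, which turns the joint
  variational inequality into one for a single player.\<close>

lemma inner_unilateral_deviation:
  fixes x y :: "('a::real_inner) ^ 'p::finite"
  shows "inner y ((\<chi> j. if j = i then w else x $ j) - x) = inner (y $ i) (w - x $ i)"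
proof -
  have "inner y ((\<chi> j. if j = i then w else x $ j) - x)
      = (\<Sum>j\<in>UNIV. if j = i then inner (y $ i) (w - x $ i) else 0)"
    unfolding inner_vec_def by (rule sum.cong) auto
  then show ?thesis by simp
qed

theorem theorem3p3:
  fixes n :: "'p::finite \<Rightarrow> nat"
    and C :: "'p \<Rightarrow> 'm::finite set"
    and X :: "'p \<Rightarrow> (real ^ 'm) set"
    and K P :: "'p \<Rightarrow> real ^ 'm ^ 'p \<Rightarrow> (real ^ 'm) set"
    and x :: "real ^ 'm ^ 'p"
  assumes dim: "\<And>i. card (C i) = n i"
    and X_sub: "\<And>i. X i \<subseteq> coord_space (C i)"
    and K_map: "\<And>i. multimap (strategy_product X) (X i) (K i)"
    and P_map: "\<And>i. multimap (strategy_product X) (X i) (P i)"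
    and K_nonempty: "\<And>i y. y \<in> strategy_product X \<Longrightarrow> K i y \<noteq> {}"
    and P_open: "\<And>i. open_upper_sections (strategy_product X) (coord_space (C i)) (P i)"
    and sol: "QVI_solution (strategy_product X)
                (\<lambda>y. strategy_product (\<lambda>i. player_T C P i y))
                (\<lambda>y. strategy_product (\<lambda>i. K i y)) x"
  shows "equilibrium X K P x"
proof -
  from sol obtain y where xX: "x \<in> strategy_product X" and xK: "\<And>i. x $ i \<in> K i x"
    and y: "\<And>i. y $ i \<in> player_T C P i x"
    and vi: "\<And>z. z \<in> strategy_product (\<lambda>i. K i x) \<Longrightarrow> inner y (z - x) \<ge> 0"
    unfolding QVI_solution_def by (auto simp: strategy_product_def)
  have "P i x \<inter> K i x = {}" for i
  proof (rule ccontr)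
    assume "P i x \<inter> K i x \<noteq> {}"
    then obtain w where wP: "w \<in> P i x" and wK: "w \<in> K i x" by blast
    \<comment> \<open>The deviation is feasible because the constraint sets stay frozen at
      \<open>x\<close>: the other players keep \<open>x $ j\<close>, which lies in
      \<open>K j x\<close>.\<close>
    have "(\<chi> j. if j = i then w else x $ j) \<in> strategy_product (\<lambda>i. K i x)"
      using xK wK by (simp add: strategy_product_def)
    from vi[OF this] have "inner (y $ i) (w - x $ i) \<ge> 0"
      by (simp only: inner_unilateral_deviation)
    moreover have "openin (top_of_set (coord_space (C i))) (P i x)"
      using P_open xX by (auto simp: open_upper_sections_def)
    then have "inner (y $ i) (w - x $ i) < 0"
      using wP y by (rule player_T_neg)
    ultimately show False by linarith
  qed
  with xX xK show ?thesis by (simp add: equilibrium_def)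
qed

end
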